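(* Let $A=(a,b,c,d,u_0,w_0)$ be real parameters with $ad-bc=1$ and $b\neq 0$. Let $\phi\in L^2(\mathbb{R})\setminus\{0\}$ be a window function and $f\in L^2(\mathbb{R})$, and put $Pf(t)=f(-t)$, $P\phi(t)=\phi(-t)$. Then for all $u,w\in\mathbb{R}$, $$V^{A}_{P\phi}\{Pf\}(u,w)=V^{A}_{\phi}\{f\}(2u_0-u,\,-w)\;e^{i2w_0(u-u_0)}.$$
   Context: All functions are complex-valued. For $A=(a,b,c,d,u_0,w_0)\in\mathbb{R}^6$ with $ad-bc=1$, $b\neq 0$, the offset linear canonical transform kernel is $$K_A(t,u)=\frac{1}{\sqrt{i2\pi b}}\exp\Big(i\frac{a}{2b}t^2-i\frac1b t(u-u_0)-i\frac1b u(du_0-bw_0)+i\frac{d}{2b}(u^2+u_0^2)\Big)$$ (principal square root). For $\phi\in L^2(\mathbb{R})\setminus\{0\}$ and $f\in L^2(\mathbb{R})$, the windowed offset linear canonical transform (WOLCT) is $$V^A_\phi \{f\}(u,w)=V^A_\phi f(u,w)=\int_{\mathbb{R}} f(t)\,\overline{\phi(t-w)}\,K_A(t,u)\,dt .$$ *)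

theory Defs
  imports "HOL-Analysis.Analysis"
begin

text \<open>Square-integrable functions as representatives; the zero class of \<open>L\<^sup>2(\<real>)\<close> consists of the
  functions vanishing almost everywhere.\<close>

definition L2_real :: "(real \<Rightarrow> complex) set" where
  "L2_real = {f. f \<in> borel_measurable lebesgue \<and> integrable lebesgue (\<lambda>t. (cmod (f t))\<^sup>2)}"

definition L2_null :: "(real \<Rightarrow> complex) set" where
  "L2_null = {f \<in> L2_real. AE t in lebesgue. f t = 0}"

type_synonym olct_param = "real \<times> real \<times> real \<times> real \<times> real \<times> real"

fun olct_kernel :: "olct_param \<Rightarrow> real \<Rightarrow> real \<Rightarrow> complex" where
  "olct_kernel (a, b, c, d, u0, w0) t u =
     1 / csqrt (\<i> * 2 * of_real pi * of_real b) *
     exp (\<i> * of_real (a / (2 * b) * t\<^sup>2)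
          - \<i> * of_real (1 / b * t * (u - u0))
          - \<i> * of_real (1 / b * u * (d * u0 - b * w0))
          + \<i> * of_real (d / (2 * b) * (u\<^sup>2 + u0\<^sup>2)))"

definition wolct :: "olct_param \<Rightarrow> (real \<Rightarrow> complex) \<Rightarrow> (real \<Rightarrow> complex) \<Rightarrow> real \<Rightarrow> real \<Rightarrow> complex" where
  "wolct A \<phi> f u w = (LINT t|lebesgue. f t * cnj (\<phi> (t - w)) * olct_kernel A t u)"

definition parity :: "(real \<Rightarrow> complex) \<Rightarrow> real \<Rightarrow> complex" where
  "parity f t = f (- t)"

end

theory Submission imports Defs begin

text \<open>The point reflection \<open>(t, u) \<mapsto> (-t, 2 u\<^sub>0 - u)\<close> preserves the chirp \<open>t\<^sup>2\<close> and the cross term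
  \<open>t (u - u\<^sub>0)\<close> of the kernel phase, so it changes the kernel only by a factor independent of \<open>t\<close>. The substitution
  \<open>t \<mapsto> -t\<close> in the integral then gives the claim.\<close>

lemma olct_kernel_reflect:
  assumes "b \<noteq> 0"
  shows "olct_kernel (a, b, c, d, u0, w0) (- t) u =
    olct_kernel (a, b, c, d, u0, w0) t (2 * u0 - u) * exp (\<i> * of_real (2 * w0 * (u - u0)))"
proof -
  \<comment> \<open>Between \<open>u\<close> and \<open>2 * u0 - u\<close> the \<open>d\<close>
    parts of the last two terms cancel, leaving only \<open>2 * w0 * (u - u0)\<close>.\<close>
  have phase: "a / (2 * b) * (- t)\<^sup>2 - 1 / b * (- t) * (u - u0) - 1 / b * u * (d * u0 - b * w0)
        + d / (2 * b) * (u\<^sup>2 + u0\<^sup>2)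
      = a / (2 * b) * t\<^sup>2 - 1 / b * t * ((2 * u0 - u) - u0)
        - 1 / b * (2 * u0 - u) * (d * u0 - b * w0)
        + d / (2 * b) * ((2 * u0 - u)\<^sup>2 + u0\<^sup>2) + 2 * w0 * (u - u0)"
    using assms by (simp add: field_simps power2_eq_square)
  \<comment> \<open>Gathers the exponent into one real phase, so that \<open>phase\<close> can
    rewrite it.\<close>
  have exponent: "\<i> * of_real p - \<i> * of_real q - \<i> * of_real r + \<i> * of_real s
      = \<i> * complex_of_real (p - q - r + s)" for p q r s
    by (simp add: algebra_simps)
  show ?thesis
    unfolding olct_kernel.simps exponent phase
    by (simp only: of_real_add distrib_left exp_add mult.assoc)
qed

theorem mainTheorem8:
  fixes a b c d u0 w0 :: real and \<phi> f :: "real \<Rightarrow> complex"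
  assumes "a * d - b * c = 1" and "b \<noteq> 0"
    and "\<phi> \<in> L2_real - L2_null" and "f \<in> L2_real"
  shows "\<forall>u w :: real.
    wolct (a, b, c, d, u0, w0) (parity \<phi>) (parity f) u w =
    wolct (a, b, c, d, u0, w0) \<phi> f (2 * u0 - u) (- w) * exp (\<i> * of_real (2 * w0 * (u - u0)))"
proof (intro allI)
  fix u w :: real
  let ?A = "(a, b, c, d, u0, w0)" and ?e = "exp (\<i> * of_real (2 * w0 * (u - u0)))"
  have "wolct ?A (parity \<phi>) (parity f) u w =
      (LINT t|lebesgue. parity f (- t) * cnj (parity \<phi> (- t - w)) * olct_kernel ?A (- t) u)"
    unfolding wolct_def by (subst lebesgue_integral_real_affine[of "-1" _ 0])
      (simp_all del: olct_kernel.simps)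
  \<comment> \<open>The sign of \<open>w\<close> flips because
    \<open>parity \<phi> (- t - w)\<close> is \<open>\<phi> (t + w)\<close>.\<close>
  also have "\<dots> = (LINT t|lebesgue. f t * cnj (\<phi> (t - - w)) * olct_kernel ?A t (2 * u0 - u) * ?e)"
    unfolding olct_kernel_reflect[OF \<open>b \<noteq> 0\<close>]
    by (simp add: parity_def mult.assoc add.commute del: olct_kernel.simps)
  also have "\<dots> = wolct ?A \<phi> f (2 * u0 - u) (- w) * ?e"
    \<comment> \<open>The factor is constant in \<open>t\<close>; were the integrand not integrable,
      both sides would be 0 by convention.\<close>
    unfolding wolct_def by (rule integral_mult_left_zero)
  finally show "wolct ?A (parity \<phi>) (parity f) u w = wolct ?A \<phi> f (2 * u0 - u) (- w) * ?e" .
qed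

end
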